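(* Let $H\in(0,1)$, $a\in\mathbb{R}$, $\sigma>0$, $X_0>0$, and let $B^H=\{B^H_t,t\ge0\}$ be a fractional Brownian motion with Hurst parameter $H$. Let $Y$ be the fractional Ornstein--Uhlenbeck process $$Y_t=\sqrt{X_0}+a\int_0^tY_s\,ds+\sigma B^H_t,\qquad t\ge0,$$ let $\tau=\inf\{s>0: Y_s=0\}$, and let $X_t=Y_t^2\,\mathbf{1}_{\{t<\tau\}}$, $t\ge0$, be the fractional Cox--Ingersoll--Ross process. Put $\tilde a=2a$ and $\tilde\sigma=2\sigma$. Then, pathwise, for every $t<\tau$ the pathwise Stratonovich integral $\int_0^t\sqrt{X_s}\circ dB^H_s$ exists and $$X_t=X_0+\tilde a\int_0^tX_s\,ds+\tilde\sigma\int_0^t\sqrt{X_s}\circ dB^H_s.$$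
   Context: A fractional Brownian motion with Hurst parameter $H\in(0,1)$ is a centered Gaussian process $\{B^H_t,t\ge0\}$ with continuous paths and covariance $\mathsf{E}B^H_tB^H_s=\frac12\left(t^{2H}+s^{2H}-|t-s|^{2H}\right)$. Pathwise Stratonovich integral: for random processes $\{X_t\}$, $\{Y_t\}$, the integral $\int_0^TX_s\circ dY_s$ is the pathwise limit of the sums $$\sum_{k=1}^n\frac{X_{t_k}+X_{t_{k-1}}}{2}\left(Y_{t_k}-Y_{t_{k-1}}\right)$$ as the mesh of the partition $0=t_0<t_1<\dots<t_n=T$ tends to zero, in case this limit exists. *)

theory Defs
  imports "HOL-Probability.Probability"
begin

text \<open>Constants count as degenerate Gaussian variables; this is needed for the process at time 0,
  where the variance vanishes.\<close>

definition gaussian_rv :: "'a measure \<Rightarrow> ('a \<Rightarrow> real) \<Rightarrow> bool" where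
  "gaussian_rv M Z \<longleftrightarrow> Z \<in> borel_measurable M \<and>
     (\<exists>\<mu>. (AE \<omega> in M. Z \<omega> = \<mu>) \<or>
          (\<exists>s>0. distributed M lborel Z (\<lambda>x. ennreal (normal_density \<mu> s x))))"

definition gaussian_process :: "'a measure \<Rightarrow> (real \<Rightarrow> 'a \<Rightarrow> real) \<Rightarrow> bool" where
  "gaussian_process M Z \<longleftrightarrow>
     (\<forall>I c. finite I \<and> I \<subseteq> {0..} \<longrightarrow> gaussian_rv M (\<lambda>\<omega>. \<Sum>t\<in>I. c t * Z t \<omega>))"

locale fractional_brownian_motion = prob_space M
  for M :: "'a measure" and H :: real and B :: "real \<Rightarrow> 'a \<Rightarrow> real" +
  assumes Hurst: "0 < H" "H < 1"
    and gaussian: "gaussian_process M B"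
    and centered: "\<And>t. 0 \<le> t \<Longrightarrow> expectation (B t) = 0"
    and continuous_paths: "\<And>\<omega>. \<omega> \<in> space M \<Longrightarrow> continuous_on {0..} (\<lambda>t. B t \<omega>)"
    and covariance: "\<And>t s. 0 \<le> t \<Longrightarrow> 0 \<le> s \<Longrightarrow>
      expectation (\<lambda>\<omega>. B t \<omega> * B s \<omega>) =
        (t powr (2 * H) + s powr (2 * H) - \<bar>t - s\<bar> powr (2 * H)) / 2"

text \<open>Partitions \<open>0 = p 0 < \<dots> < p n = T\<close>; for \<open>T = 0\<close> the only one has \<open>n = 0\<close>, so the
  Stratonovich integral over \<open>[0, 0]\<close> is 0.\<close>

definition is_partition :: "real \<Rightarrow> nat \<Rightarrow> (nat \<Rightarrow> real) \<Rightarrow> bool" where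
  "is_partition T n p \<longleftrightarrow> p 0 = 0 \<and> p n = T \<and> (\<forall>k\<in>{1..n}. p (k - 1) < p k)"

definition stratonovich_sum ::
    "(real \<Rightarrow> real) \<Rightarrow> (real \<Rightarrow> real) \<Rightarrow> nat \<Rightarrow> (nat \<Rightarrow> real) \<Rightarrow> real" where
  "stratonovich_sum x y n p =
     (\<Sum>k=1..n. (x (p k) + x (p (k - 1))) / 2 * (y (p k) - y (p (k - 1))))"

definition has_stratonovich_integral ::
    "(real \<Rightarrow> real) \<Rightarrow> (real \<Rightarrow> real) \<Rightarrow> real \<Rightarrow> real \<Rightarrow> bool" where
  "has_stratonovich_integral x y T I \<longleftrightarrow>
     (\<forall>\<epsilon>>0. \<exists>\<delta>>0. \<forall>n p. is_partition T n p \<and> (\<forall>k\<in>{1..n}. p k - p (k - 1) < \<delta>) \<longrightarrow>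
        \<bar>stratonovich_sum x y n p - I\<bar> < \<epsilon>)"

definition stratonovich_integrable :: "(real \<Rightarrow> real) \<Rightarrow> (real \<Rightarrow> real) \<Rightarrow> real \<Rightarrow> bool" where
  "stratonovich_integrable x y T \<longleftrightarrow> (\<exists>I. has_stratonovich_integral x y T I)"

definition stratonovich_integral :: "(real \<Rightarrow> real) \<Rightarrow> (real \<Rightarrow> real) \<Rightarrow> real \<Rightarrow> real" where
  "stratonovich_integral x y T = (THE I. has_stratonovich_integral x y T I)"

text \<open>\<open>Y\<close> solves \<open>Y\<^sub>t = y\<^sub>0 + a \<integral>\<^sub>0\<^sup>t Y\<^sub>s ds + \<sigma> B\<^sub>t\<close> on every path. Integrability is part of the
  equation because \<open>integral\<close> is 0 on functions that are not integrable. Indefinite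
  Henstock-Kurzweil integrals are continuous, so \<open>Y\<close> has continuous paths when \<open>B\<close> does.\<close>

definition fractional_OU ::
    "'a measure \<Rightarrow> real \<Rightarrow> real \<Rightarrow> real \<Rightarrow> (real \<Rightarrow> 'a \<Rightarrow> real) \<Rightarrow> (real \<Rightarrow> 'a \<Rightarrow> real) \<Rightarrow> bool" where
  "fractional_OU M y\<^sub>0 a \<sigma> B Y \<longleftrightarrow> (\<forall>\<omega>\<in>space M. \<forall>t\<ge>0.
     (\<lambda>s. Y s \<omega>) integrable_on {0..t} \<and>
     Y t \<omega> = y\<^sub>0 + a * integral {0..t} (\<lambda>s. Y s \<omega>) + \<sigma> * B t \<omega>)"

text \<open>Extended-real valued, so that the infimum is \<open>\<infinity>\<close> on paths that never hit 0.\<close>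

definition first_zero :: "(real \<Rightarrow> 'a \<Rightarrow> real) \<Rightarrow> 'a \<Rightarrow> ereal" where
  "first_zero Y \<omega> = Inf (ereal ` {s. 0 < s \<and> Y s \<omega> = 0})"

definition fractional_CIR :: "(real \<Rightarrow> 'a \<Rightarrow> real) \<Rightarrow> real \<Rightarrow> 'a \<Rightarrow> real" where
  "fractional_CIR Y t \<omega> = (if ereal t < first_zero Y \<omega> then (Y t \<omega>)\<^sup>2 else 0)"

end

theory Submission
  imports Defs
begin

text \<open>Before \<open>\<tau>\<close> the process \<open>Y\<close> is positive, so \<open>\<surd>X = Y\<close> there. The Stratonovich sums of
  \<open>Y\<close> against itself telescope to \<open>(Y\<^sub>t\<^sup>2 - Y\<^sub>0\<^sup>2) / 2\<close>, whatever the roughness of the path, and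
  those of \<open>Y\<close> against \<open>\<integral>Y ds\<close> are trapezoidal Riemann sums. Solving the equation of \<open>Y\<close> for \<open>B\<close>
  turns this into the assertion. Only \<open>B\<^sub>0 = 0\<close> is probabilistic, and it is the reason why the
  statement holds almost surely.\<close>

section \<open>Partitions of an interval starting at 0\<close>

lemma is_partition_mono:
  assumes "is_partition T n p" "j \<le> k" "k \<le> n"
  shows "p j \<le> p k"
  using assms(2,3)
proof (induction k rule: dec_induct)
  case (step k)
  then have "p (Suc k - 1) < p (Suc k)"
    using assms(1) unfolding is_partition_def
    by (metis One_nat_def Suc_le_mono atLeastAtMost_iff zero_le)
  with step show ?case by auto
qed simp

lemma is_partition_in_range:
  assumes "is_partition T n p" "k \<le> n"
  shows "p k \<in> {0..T}"
  using is_partition_mono[OF assms(1), of 0 k] is_partition_mono[OF assms(1), of k n] assms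
  by (auto simp: is_partition_def)

text \<open>The limit over vanishing mesh would be vacuous without arbitrarily fine partitions;
  uniqueness of the Stratonovich integral rests on this. Equidistant points serve for
  \<open>T > 0\<close>.\<close>

lemma is_partition_exists:
  assumes "0 \<le> T" "0 < \<delta>"
  obtains n p where "is_partition T n p" "\<forall>k\<in>{1..n}. p k - p (k - 1) < \<delta>"
proof (cases "T = 0")
  \<comment> \<open>Equidistant points with \<open>n > 0\<close> would not be strictly increasing
    here, so the partition without cells is taken.\<close>
  case True
  then have "is_partition T 0 (\<lambda>_. 0)" by (simp add: is_partition_def)
  then show ?thesis by (rule that) simp
next
  case False
  then have T: "0 < T" using assms by simp
  obtain n :: nat where n: "T / \<delta> < real n" using reals_Archimedean2 by blast
  then have n0: "0 < real n" using T assms by (smt (verit) divide_pos_pos)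
  have step: "real k * T / n - real (k - 1) * T / n = T / n" if "k \<in> {1..n}" for k
    using that by (simp add: of_nat_diff field_simps)
  have "T / n < \<delta>" using n n0 assms by (simp add: field_simps)
  moreover have "is_partition T n (\<lambda>k. real k * T / n)"
    unfolding is_partition_def
  proof (intro conjI ballI)
    fix k assume "k \<in> {1..n}"
    from step[OF this] show "real (k - 1) * T / n < real k * T / n"
      using divide_pos_pos[OF T n0] by linarith
  qed (use n0 in auto)
  ultimately show ?thesis using step by (intro that) auto
qed

text \<open>Lets a Stratonovich sum be compared with an ordinary integral cell by cell.\<close>

lemma sum_integral_partition:
  fixes h :: "real \<Rightarrow> real"
  assumes p: "is_partition T n p" and h: "h integrable_on {0..T}"
  shows "(\<Sum>k=1..n. integral {p (k - 1)..p k} h) = integral {0..T} h"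
proof -
  have "(\<Sum>k=1..m. integral {p (k - 1)..p k} h) = integral {0..p m} h" if "m \<le> n" for m
    using that
  proof (induction m)
    case 0
    then show ?case using p by (simp add: is_partition_def)
  next
    case (Suc m)
    have "h integrable_on {0..p (Suc m)}"
      using is_partition_in_range[OF p Suc.prems]
      by (intro integrable_on_subinterval[OF h]) auto
    then have "integral {0..p m} h + integral {p m..p (Suc m)} h = integral {0..p (Suc m)} h"
      using is_partition_in_range[OF p, of m] is_partition_mono[OF p, of m "Suc m"] Suc.prems
      by (intro Henstock_Kurzweil_Integration.integral_combine) auto
    then show ?case using Suc by simp
  qed
  from this[of n] show ?thesis using p by (simp add: is_partition_def)
qed

section \<open>Uniqueness, locality and linearity of the Stratonovich integral\<close>

lemma has_stratonovich_integral_unique: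
  assumes "has_stratonovich_integral x y T I" "has_stratonovich_integral x y T J" "0 \<le> T"
  shows "I = J"
proof (rule ccontr)
  assume "I \<noteq> J"
  then have e: "0 < \<bar>I - J\<bar> / 2" by simp
  from assms(1) e obtain d where d: "0 < d" "\<And>n p. is_partition T n p \<Longrightarrow>
      \<forall>k\<in>{1..n}. p k - p (k - 1) < d \<Longrightarrow> \<bar>stratonovich_sum x y n p - I\<bar> < \<bar>I - J\<bar> / 2"
    unfolding has_stratonovich_integral_def by meson
  from assms(2) e obtain d' where d': "0 < d'" "\<And>n p. is_partition T n p \<Longrightarrow>
      \<forall>k\<in>{1..n}. p k - p (k - 1) < d' \<Longrightarrow> \<bar>stratonovich_sum x y n p - J\<bar> < \<bar>I - J\<bar> / 2"
    unfolding has_stratonovich_integral_def by meson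
  \<comment> \<open>A single partition that is fine enough for both limits forces its sum to lie
    within half of \<open>\<bar>I - J\<bar>\<close> of both candidates.\<close>
  obtain n p where p: "is_partition T n p" "\<forall>k\<in>{1..n}. p k - p (k - 1) < min d d'"
    using is_partition_exists[OF assms(3), of "min d d'"] d d' by auto
  have "\<bar>stratonovich_sum x y n p - I\<bar> < \<bar>I - J\<bar> / 2"
    using p by (intro d(2)) auto
  moreover have "\<bar>stratonovich_sum x y n p - J\<bar> < \<bar>I - J\<bar> / 2"
    using p by (intro d'(2)) auto
  ultimately show False by (smt (verit) field_sum_of_halves)
qed

lemma stratonovich_integral_eq:
  assumes "has_stratonovich_integral x y T I" "0 \<le> T"
  shows "stratonovich_integral x y T = I"
  unfolding stratonovich_integral_def
  using assms has_stratonovich_integral_unique by (intro the_equality) blast+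

text \<open>The sums evaluate both paths only at partition points, which lie in
  \<open>{0..T}\<close>. This matters because \<open>sqrt X\<close> and \<open>Y\<close> are known
  to agree only before the first zero.\<close>

lemma has_stratonovich_integral_cong:
  assumes "\<And>s. s \<in> {0..T} \<Longrightarrow> x s = x' s" "\<And>s. s \<in> {0..T} \<Longrightarrow> y s = y' s"
  shows "has_stratonovich_integral x y T I \<longleftrightarrow> has_stratonovich_integral x' y' T I"
proof -
  have "stratonovich_sum x y n p = stratonovich_sum x' y' n p" if "is_partition T n p" for n p
    unfolding stratonovich_sum_def
  proof (rule sum.cong)
    fix k assume "k \<in> {1..n}"
    then have "p k \<in> {0..T}" "p (k - 1) \<in> {0..T}"
      using is_partition_in_range[OF that, of k] is_partition_in_range[OF that, of "k - 1"] by auto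
    then show "(x (p k) + x (p (k - 1))) / 2 * (y (p k) - y (p (k - 1))) =
      (x' (p k) + x' (p (k - 1))) / 2 * (y' (p k) - y' (p (k - 1)))"
      using assms by metis
  qed simp
  then show ?thesis unfolding has_stratonovich_integral_def by metis
qed

lemma has_stratonovich_integral_add:
  assumes "has_stratonovich_integral x y T I" "has_stratonovich_integral x z T J"
  shows "has_stratonovich_integral x (\<lambda>s. y s + z s) T (I + J)"
  unfolding has_stratonovich_integral_def
proof (intro allI impI)
  fix e :: real assume "0 < e"
  then have e: "0 < e / 2" by simp
  from assms(1) e obtain d where d: "0 < d" "\<And>n p. is_partition T n p \<Longrightarrow>
      \<forall>k\<in>{1..n}. p k - p (k - 1) < d \<Longrightarrow> \<bar>stratonovich_sum x y n p - I\<bar> < e / 2"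
    unfolding has_stratonovich_integral_def by meson
  from assms(2) e obtain d' where d': "0 < d'" "\<And>n p. is_partition T n p \<Longrightarrow>
      \<forall>k\<in>{1..n}. p k - p (k - 1) < d' \<Longrightarrow> \<bar>stratonovich_sum x z n p - J\<bar> < e / 2"
    unfolding has_stratonovich_integral_def by meson
  have "\<bar>stratonovich_sum x (\<lambda>s. y s + z s) n p - (I + J)\<bar> < e"
    if p: "is_partition T n p" "\<forall>k\<in>{1..n}. p k - p (k - 1) < min d d'" for n p
  proof -
    have "stratonovich_sum x (\<lambda>s. y s + z s) n p = stratonovich_sum x y n p + stratonovich_sum x z n p"
      unfolding stratonovich_sum_def sum.distrib[symmetric]
      by (intro sum.cong) (simp_all add: field_simps)
    moreover have "\<bar>stratonovich_sum x y n p - I\<bar> < e / 2"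
      using p by (intro d(2)) auto
    moreover have "\<bar>stratonovich_sum x z n p - J\<bar> < e / 2"
      using p by (intro d'(2)) auto
    ultimately show ?thesis by linarith
  qed
  then show "\<exists>\<delta>>0. \<forall>n p. is_partition T n p \<and> (\<forall>k\<in>{1..n}. p k - p (k - 1) < \<delta>) \<longrightarrow>
      \<bar>stratonovich_sum x (\<lambda>s. y s + z s) n p - (I + J)\<bar> < e"
    using d(1) d'(1) by (intro exI[of _ "min d d'"]) simp
qed

lemma has_stratonovich_integral_scale:
  assumes "has_stratonovich_integral x y T I"
  shows "has_stratonovich_integral x (\<lambda>s. c * y s) T (c * I)"
  unfolding has_stratonovich_integral_def
proof (intro allI impI)
  fix e :: real assume "0 < e"
  \<comment> \<open>The summand 1 keeps the denominator positive when \<open>c = 0\<close> and makes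
    the final estimate strict.\<close>
  then have e: "0 < e / (\<bar>c\<bar> + 1)" by (simp add: add_nonneg_pos)
  from assms e obtain d where d: "0 < d" "\<And>n p. is_partition T n p \<Longrightarrow>
      \<forall>k\<in>{1..n}. p k - p (k - 1) < d \<Longrightarrow> \<bar>stratonovich_sum x y n p - I\<bar> < e / (\<bar>c\<bar> + 1)"
    unfolding has_stratonovich_integral_def by meson
  have "\<bar>stratonovich_sum x (\<lambda>s. c * y s) n p - c * I\<bar> < e"
    if p: "is_partition T n p" "\<forall>k\<in>{1..n}. p k - p (k - 1) < d" for n p
  proof -
    have "stratonovich_sum x (\<lambda>s. c * y s) n p = c * stratonovich_sum x y n p"
      unfolding stratonovich_sum_def sum_distrib_left by (simp add: algebra_simps)
    then have "\<bar>stratonovich_sum x (\<lambda>s. c * y s) n p - c * I\<bar> = \<bar>c\<bar> * \<bar>stratonovich_sum x y n p - I\<bar>"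
      by (simp add: right_diff_distrib flip: abs_mult)
    also have "\<dots> \<le> \<bar>c\<bar> * (e / (\<bar>c\<bar> + 1))"
      using d(2)[OF p] by (intro mult_left_mono) auto
    also have "\<dots> < e" using \<open>0 < e\<close> by (simp add: field_simps)
    finally show ?thesis .
  qed
  then show "\<exists>\<delta>>0. \<forall>n p. is_partition T n p \<and> (\<forall>k\<in>{1..n}. p k - p (k - 1) < \<delta>) \<longrightarrow>
      \<bar>stratonovich_sum x (\<lambda>s. c * y s) n p - c * I\<bar> < e"
    using d(1) by blast
qed

section \<open>The three integrals from which the noise integral is assembled\<close>

lemma has_stratonovich_integral_const:
  "has_stratonovich_integral x (\<lambda>_. c) T 0"
  by (auto simp: has_stratonovich_integral_def stratonovich_sum_def intro!: exI[of _ 1])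

text \<open>Each summand is half a difference of squares, so the sum telescopes to the same value
  for every partition. Any mesh bound works, hence the witness 1.\<close>

lemma has_stratonovich_integral_self:
  "has_stratonovich_integral x x T (((x T)\<^sup>2 - (x 0)\<^sup>2) / 2)"
proof -
  have "stratonovich_sum x x n p = ((x (p n))\<^sup>2 - (x (p 0))\<^sup>2) / 2" for n p
    unfolding stratonovich_sum_def
    by (induction n) (auto simp: power2_eq_square field_simps)
  then show ?thesis
    by (auto simp: has_stratonovich_integral_def is_partition_def simp del: eq_divide_eq_numeral1
        intro!: exI[of _ 1])
qed

text \<open>On a short cell, uniform continuity makes the endpoint average of \<open>f\<close> close
  to every value of \<open>f\<close> there. The error of a cell is therefore small relative to its
  length, and the lengths add up to \<open>T\<close>.\<close>

lemma has_stratonovich_integral_indefinite_integral: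
  fixes f g :: "real \<Rightarrow> real"
  assumes T: "0 \<le> T" and f: "continuous_on {0..T} f" and g: "continuous_on {0..T} g"
  shows "has_stratonovich_integral f (\<lambda>t. integral {0..t} g) T (integral {0..T} (\<lambda>s. f s * g s))"
  unfolding has_stratonovich_integral_def
proof (intro allI impI)
  fix e :: real assume e: "0 < e"
  have "bounded (g ` {0..T})" using g compact_continuous_image compact_imp_bounded by blast
  then obtain K where K: "0 < K" "\<And>s. s \<in> {0..T} \<Longrightarrow> \<bar>g s\<bar> \<le> K"
    by (auto simp: bounded_pos)
  \<comment> \<open>Chosen so that the total error \<open>\<eta> * K * T\<close> stays below
    \<open>e\<close>; taking \<open>T + 1\<close> covers \<open>T = 0\<close> as well.\<close>
  define \<eta> where "\<eta> = e / (K * (T + 1))"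
  have \<eta>: "0 < \<eta>" using e K T by (simp add: \<eta>_def)
  have "uniformly_continuous_on {0..T} f" using f compact_uniformly_continuous by blast
  then obtain d where d: "0 < d"
    "\<And>s r. s \<in> {0..T} \<Longrightarrow> r \<in> {0..T} \<Longrightarrow> \<bar>r - s\<bar> < d \<Longrightarrow> \<bar>f r - f s\<bar> < \<eta>"
    using \<eta> unfolding uniformly_continuous_on_def dist_real_def by metis
  have "\<bar>stratonovich_sum f (\<lambda>t. integral {0..t} g) n p - integral {0..T} (\<lambda>s. f s * g s)\<bar> < e"
    if p: "is_partition T n p" and mesh: "\<forall>k\<in>{1..n}. p k - p (k - 1) < d" for n p
  proof -
    have term_bound: "\<bar>(f (p k) + f (p (k - 1))) / 2 * (integral {0..p k} g - integral {0..p (k - 1)} g)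
        - integral {p (k - 1)..p k} (\<lambda>s. f s * g s)\<bar> \<le> \<eta> * K * (p k - p (k - 1))"
      if k: "k \<in> {1..n}" for k
    proof -
      let ?u = "p (k - 1)" and ?v = "p k"
      let ?m = "(f ?v + f ?u) / 2"
      have uv: "?u \<in> {0..T}" "?v \<in> {0..T}"
        using k is_partition_in_range[OF p, of k] is_partition_in_range[OF p, of "k - 1"] by auto
      have le: "?u \<le> ?v" using k by (intro is_partition_mono[OF p]) auto
      have sub: "{?u..?v} \<subseteq> {0..T}" using uv by auto
      have gi: "g integrable_on {0..?v}"
        using uv by (intro integrable_continuous_real continuous_on_subset[OF g]) auto
      have "integral {0..?u} g + integral {?u..?v} g = integral {0..?v} g"
        using uv le gi by (intro Henstock_Kurzweil_Integration.integral_combine) auto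
      then have diff: "integral {0..?v} g - integral {0..?u} g = integral {?u..?v} g" by simp
      have cg: "continuous_on {?u..?v} g" and cf: "continuous_on {?u..?v} f"
        using sub f g continuous_on_subset by blast+
      have "?m * integral {?u..?v} g - integral {?u..?v} (\<lambda>s. f s * g s)
          = integral {?u..?v} (\<lambda>s. ?m * g s) - integral {?u..?v} (\<lambda>s. f s * g s)"
        by simp
      also have "\<dots> = integral {?u..?v} (\<lambda>s. ?m * g s - f s * g s)"
        by (intro Henstock_Kurzweil_Integration.integral_diff[symmetric]
            integrable_continuous_real continuous_intros cg cf)
      finally have eq: "?m * integral {?u..?v} g - integral {?u..?v} (\<lambda>s. f s * g s)
          = integral {?u..?v} (\<lambda>s. ?m * g s - f s * g s)" .
      have "norm (integral {?u..?v} (\<lambda>s. ?m * g s - f s * g s)) \<le> \<eta> * K * (?v - ?u)"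
      proof (rule integral_bound[OF le])
        show "continuous_on {?u..?v} (\<lambda>s. ?m * g s - f s * g s)"
          by (intro continuous_intros cg cf)
        fix s assume s: "s \<in> {?u..?v}"
        have "?v - ?u < d" using mesh k by blast
        then have "\<bar>f ?v - f s\<bar> < \<eta>" "\<bar>f ?u - f s\<bar> < \<eta>"
          using s uv sub by (auto intro!: d(2))
        \<comment> \<open>\<open>?m - f s\<close> is the mean of the two differences just
          bounded.\<close>
        then have "\<bar>?m - f s\<bar> \<le> \<eta>" by (simp add: abs_if field_simps split: if_splits)
        then have "\<bar>?m - f s\<bar> * \<bar>g s\<bar> \<le> \<eta> * K"
          using K s sub \<eta> by (intro mult_mono) auto
        then show "norm (?m * g s - f s * g s) \<le> \<eta> * K"
          by (simp add: left_diff_distrib flip: abs_mult)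
      qed
      then show ?thesis unfolding diff eq by simp
    qed
    have fg: "(\<lambda>s. f s * g s) integrable_on {0..T}"
      by (intro integrable_continuous_real continuous_intros f g)
    have tele: "(\<Sum>k=1..n. p k - p (k - 1)) = T"
      using p sum_telescope''[of 0 n p] by (simp add: is_partition_def atLeastSucAtMost_greaterThanAtMost)
    have "\<bar>stratonovich_sum f (\<lambda>t. integral {0..t} g) n p - integral {0..T} (\<lambda>s. f s * g s)\<bar>
        \<le> (\<Sum>k=1..n. \<eta> * K * (p k - p (k - 1)))"
      unfolding stratonovich_sum_def sum_integral_partition[OF p fg, symmetric] sum_subtractf[symmetric]
      by (intro order.trans[OF sum_abs] sum_mono term_bound)
    also have "\<dots> = \<eta> * K * T" by (simp only: tele flip: sum_distrib_left)
    also have "\<dots> < \<eta> * K * (T + 1)" using \<eta> K by (intro mult_strict_left_mono) auto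
    also have "\<dots> = e" using K(1) T unfolding \<eta>_def by (simp add: add_nonneg_eq_0_iff)
    finally show ?thesis .
  qed
  then show "\<exists>\<delta>>0. \<forall>n p. is_partition T n p \<and> (\<forall>k\<in>{1..n}. p k - p (k - 1) < \<delta>) \<longrightarrow>
      \<bar>stratonovich_sum f (\<lambda>t. integral {0..t} g) n p - integral {0..T} (\<lambda>s. f s * g s)\<bar> < e"
    using d(1) by blast
qed

text \<open>The deterministic core. Solving the equation for \<open>b\<close> gives a combination of
  \<open>y\<close>, its indefinite integral and a constant, and each of these can be integrated
  against \<open>y\<close>.\<close>

lemma has_stratonovich_integral_noise:
  fixes y b :: "real \<Rightarrow> real"
  assumes T: "0 \<le> T" and \<sigma>: "\<sigma> \<noteq> 0" and y: "continuous_on {0..T} y"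
    and eq: "\<And>t. t \<in> {0..T} \<Longrightarrow> y t = y\<^sub>0 + a * integral {0..t} y + \<sigma> * b t"
  shows "has_stratonovich_integral y b T
    (((y T)\<^sup>2 - (y 0)\<^sup>2 - 2 * a * integral {0..T} (\<lambda>s. (y s)\<^sup>2)) / (2 * \<sigma>))"
proof -
  have "has_stratonovich_integral y
      (\<lambda>t. 1 / \<sigma> * y t + (- a / \<sigma> * integral {0..t} y + - y\<^sub>0 / \<sigma>)) T
      (1 / \<sigma> * (((y T)\<^sup>2 - (y 0)\<^sup>2) / 2) + (- a / \<sigma> * integral {0..T} (\<lambda>s. y s * y s) + 0))"
    by (intro has_stratonovich_integral_add has_stratonovich_integral_scale
        has_stratonovich_integral_self has_stratonovich_integral_const
        has_stratonovich_integral_indefinite_integral T y)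
  moreover have "1 / \<sigma> * (((y T)\<^sup>2 - (y 0)\<^sup>2) / 2) + (- a / \<sigma> * integral {0..T} (\<lambda>s. y s * y s) + 0)
      = ((y T)\<^sup>2 - (y 0)\<^sup>2 - 2 * a * integral {0..T} (\<lambda>s. (y s)\<^sup>2)) / (2 * \<sigma>)"
    using \<sigma> by (simp add: power2_eq_square field_simps)
  moreover have "1 / \<sigma> * y t + (- a / \<sigma> * integral {0..t} y + - y\<^sub>0 / \<sigma>) = b t" if "t \<in> {0..T}" for t
    using eq[OF that] \<sigma> by (simp add: field_simps)
  ultimately show ?thesis
    using has_stratonovich_integral_cong[of T y y] by (metis (no_types, lifting))
qed

section \<open>Paths of \<open>B\<close> and \<open>Y\<close>: initial value, continuity, positivity
  before the first zero\<close>

lemma (in fractional_brownian_motion) AE_starts_at_zero: "AE \<omega> in M. B 0 \<omega> = 0"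
proof -
  have "gaussian_rv M (\<lambda>\<omega>. \<Sum>t\<in>{0}. 1 * B t \<omega>)"
    using gaussian unfolding gaussian_process_def by (elim allE[of _ "{0}"] allE[of _ "\<lambda>_. 1"]) auto
  then have g: "gaussian_rv M (B 0)" by simp
  then have meas: "B 0 \<in> borel_measurable M" by (simp add: gaussian_rv_def)
  \<comment> \<open>The Bochner integral is 0 on functions that are not integrable, so a vanishing
    second moment alone does not settle the claim. The Gaussian alternative does: a nondegenerate
    normal law would have variance \<open>s\<^sup>2 > 0\<close>, and a constant must equal its mean
    0.\<close>
  from g consider \<mu> where "AE \<omega> in M. B 0 \<omega> = \<mu>"
    | \<mu> s where "0 < s" "distributed M lborel (B 0) (\<lambda>x. ennreal (normal_density \<mu> s x))"
    by (auto simp: gaussian_rv_def)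
  then show ?thesis
  proof cases
    case (1 \<mu>)
    then have "expectation (B 0) = expectation (\<lambda>_. \<mu>)"
      using meas by (intro integral_cong_AE) auto
    then have "\<mu> = 0" using centered[of 0] prob_space by simp
    with 1 show ?thesis by simp
  next
    case (2 \<mu> s)
    then have "variance (B 0) = s\<^sup>2" by (intro normal_distributed_variance)
    moreover have "variance (B 0) = 0"
      using centered[of 0] covariance[of 0 0] by (simp add: power2_eq_square)
    ultimately show ?thesis using 2(1) by simp
  qed
qed

lemma fractional_OU_continuous:
  assumes "fractional_brownian_motion M H B" "fractional_OU M y\<^sub>0 a \<sigma> B Y" "\<omega> \<in> space M"
  shows "continuous_on {0..T} (\<lambda>t. Y t \<omega>)"
proof (cases "0 \<le> T")
  case True
  have "(\<lambda>s. Y s \<omega>) integrable_on {0..T}"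
    using assms(2,3) True by (simp add: fractional_OU_def)
  moreover have "continuous_on {0..T} (\<lambda>t. B t \<omega>)"
    using fractional_brownian_motion.continuous_paths[OF assms(1,3)]
    by (rule continuous_on_subset) auto
  ultimately have "continuous_on {0..T} (\<lambda>t. y\<^sub>0 + a * integral {0..t} (\<lambda>s. Y s \<omega>) + \<sigma> * B t \<omega>)"
    by (intro continuous_intros indefinite_integral_continuous_1)
  then show ?thesis
    using assms(2,3) by (elim continuous_on_eq) (auto simp: fractional_OU_def)
qed simp

text \<open>By the intermediate value theorem, a nonpositive value after a positive start forces a
  zero no later than \<open>t\<close>, which bounds the first zero from above.\<close>

lemma less_first_zero_imp_pos:
  assumes "ereal t < first_zero Y \<omega>" "continuous_on {0..t} (\<lambda>s. Y s \<omega>)" "0 < Y 0 \<omega>" "s \<in> {0..t}"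
  shows "0 < Y s \<omega>"
proof (rule ccontr)
  assume "\<not> 0 < Y s \<omega>"
  then obtain r where r: "0 \<le> r" "r \<le> s" "Y r \<omega> = 0"
    using IVT2'[of "\<lambda>s. Y s \<omega>" s 0 0] assms(3,4) continuous_on_subset[OF assms(2)]
    by (auto simp: atLeastatMost_subset_iff)
  \<comment> \<open>\<open>first_zero\<close> ranges over strictly positive times, so a zero at time
    0 has to be excluded first.\<close>
  with assms(3) have "0 < r" by (cases "r = 0") auto
  with r have "first_zero Y \<omega> \<le> ereal r"
    unfolding first_zero_def by (intro INF_lower) auto
  with assms(1,4) r show False
    by (meson atLeastAtMost_iff ereal_less_eq(3) leD order_trans)
qed

text \<open>The exceptional null set consists of paths with \<open>B 0\<close> nonzero, so it serves
  all \<open>t\<close> at once. Integrability of \<open>X\<close> is asserted separately since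
  \<open>integral\<close> defaults to 0; likewise existence of the Stratonovich integral, which is
  defined through \<open>THE\<close>.\<close>

theorem mainTheorem2:
  fixes M :: "'a measure" and H a \<sigma> x\<^sub>0 a' \<sigma>' :: real
    and B Y X :: "real \<Rightarrow> 'a \<Rightarrow> real" and \<tau> :: "'a \<Rightarrow> ereal"
  assumes "0 < H" and "H < 1" and "\<sigma> > 0" and "x\<^sub>0 > 0"
    and "fractional_brownian_motion M H B"
    and "fractional_OU M (sqrt x\<^sub>0) a \<sigma> B Y"
    and "\<tau> = first_zero Y"
    and "X = fractional_CIR Y"
    and "a' = 2 * a" and "\<sigma>' = 2 * \<sigma>"
  shows "AE \<omega> in M. \<forall>t\<ge>0. ereal t < \<tau> \<omega> \<longrightarrow>
           stratonovich_integrable (\<lambda>s. sqrt (X s \<omega>)) (\<lambda>s. B s \<omega>) t \<and>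
           (\<lambda>s. X s \<omega>) integrable_on {0..t} \<and>
           X t \<omega> = x\<^sub>0 + a' * integral {0..t} (\<lambda>s. X s \<omega>)
             + \<sigma>' * stratonovich_integral (\<lambda>s. sqrt (X s \<omega>)) (\<lambda>s. B s \<omega>) t"
proof -
  interpret fractional_brownian_motion M H B by fact
  show ?thesis
  proof (rule AE_mp[OF AE_starts_at_zero], intro AE_I2 impI allI)
    fix \<omega> t
    assume \<omega>: "\<omega> \<in> space M" and B0: "B 0 \<omega> = 0" and t: "0 \<le> t" "ereal t < \<tau> \<omega>"
    have cont: "continuous_on {0..t} (\<lambda>s. Y s \<omega>)"
      by (rule fractional_OU_continuous[OF assms(5,6) \<omega>])
    have OU: "Y s \<omega> = sqrt x\<^sub>0 + a * integral {0..s} (\<lambda>s. Y s \<omega>) + \<sigma> * B s \<omega>" if "0 \<le> s" for s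
      using assms(6) \<omega> that by (simp add: fractional_OU_def)
    \<comment> \<open>The only use of \<open>B0\<close>: it makes the equation at time 0 give the
      prescribed initial value.\<close>
    have Y0: "Y 0 \<omega> = sqrt x\<^sub>0" using OU[of 0] B0 by simp
    have X: "X s \<omega> = (Y s \<omega>)\<^sup>2" if "s \<in> {0..t}" for s
    proof -
      have "ereal s < first_zero Y \<omega>"
        using that t assms(7) by (metis atLeastAtMost_iff ereal_less_eq(3) order_le_less_trans)
      then show ?thesis by (simp add: assms(8) fractional_CIR_def)
    qed
    have sqrtX: "sqrt (X s \<omega>) = Y s \<omega>" if "s \<in> {0..t}" for s
      \<comment> \<open>The root of the square is the absolute value, and positivity before
        \<open>\<tau>\<close> removes it.\<close>
      using less_first_zero_imp_pos[of t Y \<omega> s] that t cont Y0 X[OF that] assms(4,7) by simp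
    \<comment> \<open>This is the value that the asserted identity dictates for the integral;
      multiplying by \<open>2 * \<sigma>\<close> and using \<open>Y0\<close> recovers the
      identity.\<close>
    let ?I = "((Y t \<omega>)\<^sup>2 - (Y 0 \<omega>)\<^sup>2 - 2 * a * integral {0..t} (\<lambda>s. (Y s \<omega>)\<^sup>2)) / (2 * \<sigma>)"
    have "has_stratonovich_integral (\<lambda>s. Y s \<omega>) (\<lambda>s. B s \<omega>) t ?I"
      using assms(3) t OU cont by (intro has_stratonovich_integral_noise) auto
    then have I: "has_stratonovich_integral (\<lambda>s. sqrt (X s \<omega>)) (\<lambda>s. B s \<omega>) t ?I"
      using has_stratonovich_integral_cong[of t "\<lambda>s. sqrt (X s \<omega>)" "\<lambda>s. Y s \<omega>"
          "\<lambda>s. B s \<omega>" "\<lambda>s. B s \<omega>"] sqrtX by simp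
    have "(\<lambda>s. (Y s \<omega>)\<^sup>2) integrable_on {0..t}"
      by (intro integrable_continuous_real continuous_intros cont)
    then have int: "(\<lambda>s. X s \<omega>) integrable_on {0..t}"
      by (rule integrable_eq) (simp add: X)
    have "integral {0..t} (\<lambda>s. X s \<omega>) = integral {0..t} (\<lambda>s. (Y s \<omega>)\<^sup>2)"
      using X by (intro Henstock_Kurzweil_Integration.integral_cong) auto
    then have "X t \<omega> = x\<^sub>0 + a' * integral {0..t} (\<lambda>s. X s \<omega>)
        + \<sigma>' * stratonovich_integral (\<lambda>s. sqrt (X s \<omega>)) (\<lambda>s. B s \<omega>) t"
      unfolding stratonovich_integral_eq[OF I t(1)]
      using X[of t] t Y0 assms(3,4,9,10) by simp
    with I int show "stratonovich_integrable (\<lambda>s. sqrt (X s \<omega>)) (\<lambda>s. B s \<omega>) t \<and>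
        (\<lambda>s. X s \<omega>) integrable_on {0..t} \<and>
        X t \<omega> = x\<^sub>0 + a' * integral {0..t} (\<lambda>s. X s \<omega>)
          + \<sigma>' * stratonovich_integral (\<lambda>s. sqrt (X s \<omega>)) (\<lambda>s. B s \<omega>) t"
      unfolding stratonovich_integrable_def by blast
  qed
qed

end
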